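(* Let $n\in\mathbb{N}=\{1,2,\dots\}$ and let $E\subset\mathbb{C}^n$ be a set of zero relative Lebesgue density in $\mathbb{C}^n$, i.e. ${\sf L}_{2n}(E)=0$ when $\mathbb{C}^n$ is identified with $\mathbb{R}^{2n}$. Then: (i) every plurisubharmonic function of finite order on $\mathbb{C}^n$ that is bounded above on $\mathbb{C}^n\setminus E$ is constant; (ii) every entire function $f$ of finite order on $\mathbb{C}^n$ such that $|f|$ is bounded above on $\mathbb{C}^n\setminus E$ is constant.
   Context: $\mathbb{C}^n$ is identified with $\mathbb{R}^{2n}$ with Euclidean norm $|\cdot|$; $\lambda$ is Lebesgue measure on $\mathbb{R}^{2n}$ and $B(r)$ is the ball of radius $r$ centred at $0$. The relative Lebesgue density of a Lebesgue measurable set $E\subset\mathbb{R}^{2n}$ is ${\sf L}_{2n}(E):=\lim_{r\to+\infty}\lambda(E\cap B(r))/r^{2n}$, if the limit exists; ${\sf L}_{2n}(E)=0$ means that $E$ is Lebesgue measurable and this limit exists and equals $0$. The order of an extended-real-valued function $M$ on $\mathbb{C}^n$ is $\limsup_{|z|\to\infty}\dfrac{\ln(1+M^+(z))}{\ln|z|}\in[0,+\infty]$, where $M^+:=\max\{0,M\}$; finite order means this quantity is $<+\infty$. An entire function is a holomorphic function $f:\mathbb{C}^n\to\mathbb{C}$; its order is defined to be the order of the function $\ln|f|$ (with $\ln 0=-\infty$). A plurisubharmonic function on $\mathbb{C}^n$ is an upper semicontinuous function with values in $[-\infty,+\infty)$ whose restriction to every complex line is subharmonic (the constant $-\infty$ being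 allowed as a subharmonic function). *)

theory Defs
  imports "HOL-Analysis.Analysis"
begin

section \<open>Relative Lebesgue density\<close>

text \<open>
  On \<open>complex ^ 'n\<close> the norm is the Euclidean norm of $\mathbb{R}^{2n}$, \<open>lebesgue\<close> is the
  Lebesgue measure of $\mathbb{R}^{2n}$, and \<open>DIM(complex ^ 'n)\<close> is the real dimension $2n$.
  The quotient is not normalised by the volume of the unit ball.
\<close>

definition has_relative_Lebesgue_density :: "'a::euclidean_space set \<Rightarrow> real \<Rightarrow> bool" where
  "has_relative_Lebesgue_density E l \<longleftrightarrow>
     E \<in> sets lebesgue \<and>
     ((\<lambda>r. measure lebesgue (E \<inter> ball 0 r) / r ^ DIM('a)) \<longlongrightarrow> l) at_top"


section \<open>Order of growth\<close>

text \<open>The library's real \<open>ln\<close> is total with \<open>ln 0 = 0\<close>; here $\ln 0 = -\infty$.\<close>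

definition eln :: "ereal \<Rightarrow> ereal" where
  "eln x = (if x \<le> 0 then -\<infinity> else if x = \<infinity> then \<infinity> else ereal (ln (real_of_ereal x)))"

definition growth_order :: "('a::real_normed_vector \<Rightarrow> ereal) \<Rightarrow> ereal" where
  "growth_order M = Limsup at_infinity (\<lambda>z. eln (1 + max 0 (M z)) / ereal (ln (norm z)))"


section \<open>Subharmonic and plurisubharmonic functions\<close>

definition upper_semicontinuous :: "('a::topological_space \<Rightarrow> ereal) \<Rightarrow> bool" where
  "upper_semicontinuous u \<longleftrightarrow> (\<forall>a. open {x. u x < a})"

text \<open>
  The mean of \<open>v\<close> over the circle of centre \<open>c\<close> and radius \<open>r\<close>, as the integral of
  the positive part minus that of the negative part (\<open>e2ennreal\<close> sends negative numbers to \<open>0\<close>).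
  For upper semicontinuous \<open>v < \<infinity>\<close> the first integral is finite, so the difference is a
  genuine element of $[-\infty, +\infty)$.
\<close>

definition circle_mean :: "(complex \<Rightarrow> ereal) \<Rightarrow> complex \<Rightarrow> real \<Rightarrow> ereal" where
  "circle_mean v c r =
     (enn2ereal (\<integral>\<^sup>+t\<in>{0..2 * pi}. e2ennreal (v (c + of_real r * cis t)) \<partial>lborel) -
      enn2ereal (\<integral>\<^sup>+t\<in>{0..2 * pi}. e2ennreal (- v (c + of_real r * cis t)) \<partial>lborel))
     / ereal (2 * pi)"

text \<open>Subharmonicity on the whole plane; the constant $-\infty$ is allowed.\<close>

definition subharmonic :: "(complex \<Rightarrow> ereal) \<Rightarrow> bool" where
  "subharmonic v \<longleftrightarrow>
     upper_semicontinuous v \<and> (\<forall>z. v z < \<infinity>) \<and>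
     (\<forall>c. \<forall>r>0. v c \<le> circle_mean v c r)"

definition plurisubharmonic :: "(complex ^ 'n \<Rightarrow> ereal) \<Rightarrow> bool" where
  "plurisubharmonic u \<longleftrightarrow>
     upper_semicontinuous u \<and> (\<forall>z. u z < \<infinity>) \<and>
     (\<forall>a b. b \<noteq> 0 \<longrightarrow> subharmonic (\<lambda>\<zeta>. u (a + \<zeta> *s b)))"


section \<open>Entire functions of several variables\<close>

text \<open>
  The library's \<open>holomorphic_on\<close> covers one variable only. Holomorphic means here that the
  Frechet derivative exists at every point and is complex-linear (real linearity is part of
  \<open>has_derivative\<close>).
\<close>

definition entire :: "(complex ^ 'n \<Rightarrow> complex) \<Rightarrow> bool" where
  "entire f \<longleftrightarrow>
     (\<forall>z. \<exists>D. (f has_derivative D) (at z) \<and> (\<forall>c v. D (c *s v) = c * D v))"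

definition entire_order :: "(complex ^ 'n \<Rightarrow> complex) \<Rightarrow> ereal" where
  "entire_order f = growth_order (\<lambda>z. eln (ereal (cmod (f z))))"

end

theory Submission
  imports Defs "HOL-Complex_Analysis.Complex_Analysis"
begin

text \<open>
  Averaging the circle inequality over a ball with respect to the rotations \<open>w \<mapsto> e\<^sup>i\<^sup>t w\<close>
  gives the sub-mean value inequality for balls. Hence if \<open>G \<ge> 0\<close> has sub-means and vanishes
  off \<open>E\<close>, the supremum of \<open>G\<close> over the ball of radius \<open>R\<close> is at most \<open>\<epsilon>(R)\<close> times that over the
  ball of radius \<open>2R\<close>, where \<open>\<epsilon>(R) \<rightarrow> 0\<close> by zero density. Iterating this along \<open>2\<^sup>j R\<close> beats
  any polynomial growth, so \<open>G = 0\<close>. Applied to truncations of \<open>u\<close> and of \<open>ln |f|\<close> this gives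
  global upper bounds, and Liouville's theorem on complex lines finishes the proof.
\<close>

subsection \<open>Mean values over balls\<close>

lemma lborel_translation_nn:
  fixes a :: "'a::euclidean_space"
  assumes "f \<in> borel_measurable borel"
  shows "(\<integral>\<^sup>+x. f (x + a) \<partial>lborel) = (\<integral>\<^sup>+x. f x \<partial>lborel)"
proof -
  have "(\<integral>\<^sup>+x. f x \<partial>lborel) = (\<integral>\<^sup>+x. f x \<partial>distr lborel borel ((+) a))"
    by (simp add: lborel_distr_plus)
  also have "\<dots> = (\<integral>\<^sup>+x. f (a + x) \<partial>lborel)"
    using assms by (subst nn_integral_distr) auto
  finally show ?thesis by (simp add: add.commute)
qed

text \<open>Uniqueness of Haar measure by Fubini: for translation-invariant \<open>N\<close> and the symmetric unit
  ball \<open>B\<close>, \<open>N A * lborel B = lborel A * N B\<close>; and \<open>T\<close> preserves \<open>B\<close>.\<close>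

lemma lborel_distr_linear_isometry:
  fixes T :: "'a::euclidean_space \<Rightarrow> 'a"
  assumes lin: "linear T" and iso: "\<And>x. norm (T x) = norm x"
  shows "distr lborel borel T = lborel"
proof -
  define N where "N = distr lborel borel T"
  have T[measurable]: "T \<in> borel_measurable borel"
    using lin linear_continuous_on linear_conv_bounded_linear borel_measurable_continuous_onI by blast
  have "inj T"
    using lin iso by (metis linear_inj_iff_eq_0 norm_eq_zero)
  then have "surj T" using lin linear_injective_imp_surjective by blast
  have setsN: "sets N = sets borel" by (simp add: N_def)
  have transN: "(\<integral>\<^sup>+x. f (x + y) \<partial>N) = (\<integral>\<^sup>+x. f x \<partial>N)"
    if [measurable]: "f \<in> borel_measurable borel" for f and y :: 'a
  proof -
    obtain z where z: "y = T z" using \<open>surj T\<close> by (meson surjD)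
    have "(\<integral>\<^sup>+x. f (x + y) \<partial>N) = (\<integral>\<^sup>+x. f (T x + T z) \<partial>lborel)"
      unfolding N_def z by (subst nn_integral_distr) auto
    also have "\<dots> = (\<integral>\<^sup>+x. f (T (x + z)) \<partial>lborel)"
      using lin by (simp add: linear_add)
    also have "\<dots> = (\<integral>\<^sup>+x. f (T x) \<partial>lborel)"
      by (rule lborel_translation_nn[where f = "\<lambda>x. f (T x)"]) simp
    also have "\<dots> = (\<integral>\<^sup>+x. f x \<partial>N)"
      unfolding N_def by (subst nn_integral_distr) auto
    finally show ?thesis .
  qed
  define b where "b = emeasure lborel (ball (0::'a) 1)"
  have b: "b \<noteq> 0" "b \<noteq> \<infinity>"
    using content_ball_pos[of 1 "0::'a"] emeasure_lborel_ball_finite[of "0::'a" 1]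
    by (auto simp: b_def measure_def)
  have ballN: "emeasure N (ball 0 1) = b"
  proof -
    have "T -` ball 0 1 = ball 0 1" by (auto simp: iso)
    then show ?thesis unfolding N_def b_def by (subst emeasure_distr) auto
  qed
  define B where "B = ball (0::'a) 1"
  have [measurable]: "B \<in> sets borel" by (simp add: B_def)
  have reflN: "(\<integral>\<^sup>+x. indicator B (y - x) \<partial>N) = b" for y :: 'a
  proof -
    have "(\<integral>\<^sup>+x. indicator B (y - x) \<partial>N) = (\<integral>\<^sup>+x. indicator B (x + - y) \<partial>N)"
      by (intro nn_integral_cong) (auto simp: B_def indicator_def dist_norm norm_minus_commute)
    also have "\<dots> = (\<integral>\<^sup>+x. indicator B x \<partial>N)"
      by (rule transN) measurable
    finally show ?thesis using ballN setsN by (simp add: B_def)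
  qed
  have eq: "emeasure N A = emeasure lborel A" if A[measurable]: "A \<in> sets borel" for A
  proof -
    interpret N: sigma_finite_measure N
    proof
      show "\<exists>F. countable F \<and> F \<subseteq> sets N \<and> \<Union> F = space N \<and> (\<forall>a\<in>F. emeasure N a \<noteq> \<infinity>)"
      proof (intro exI[of _ "range (\<lambda>n::nat. ball 0 (real n))"] conjI)
        show "\<Union> (range (\<lambda>n::nat. ball 0 (real n))) = space N"
          by (auto simp: N_def intro: reals_Archimedean2)
        have "emeasure N (ball 0 (real n)) = emeasure lborel (ball (0::'a) (real n))" for n
        proof -
          have "T -` ball 0 (real n) = ball 0 (real n)" by (auto simp: iso)
          then show ?thesis unfolding N_def by (subst emeasure_distr) auto
        qed
        then show "\<forall>a\<in>range (\<lambda>n::nat. ball 0 (real n)). emeasure N a \<noteq> \<infinity>"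
          using emeasure_lborel_ball_finite by (auto simp: less_top[symmetric])
      qed (auto simp: setsN)
    qed
    interpret pair_sigma_finite N "lborel :: 'a measure" ..
    have [measurable_cong]: "sets N = sets borel" by fact
    have "emeasure N A * b = (\<integral>\<^sup>+x. indicator A x * (\<integral>\<^sup>+y. indicator B y \<partial>lborel) \<partial>N)"
      by (subst nn_integral_multc) (auto simp: b_def B_def[symmetric] setsN)
    also have "\<dots> = (\<integral>\<^sup>+x. \<integral>\<^sup>+y. indicator A x * indicator B y \<partial>lborel \<partial>N)"
      by (subst nn_integral_cmult) auto
    also have "\<dots> = (\<integral>\<^sup>+y. \<integral>\<^sup>+x. indicator A x * indicator B y \<partial>N \<partial>lborel)"
      by (rule Fubini'[symmetric]) measurable
    also have "\<dots> = (\<integral>\<^sup>+y. \<integral>\<^sup>+x. indicator A (x + y) * indicator B y \<partial>N \<partial>lborel)"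
      using transN[where f = "\<lambda>x. indicator A x * indicator B y" and y = y for y]
      by simp
    also have "\<dots> = (\<integral>\<^sup>+x. \<integral>\<^sup>+y. indicator A (x + y) * indicator B y \<partial>lborel \<partial>N)"
      by (rule Fubini') measurable
    also have "\<dots> = (\<integral>\<^sup>+x. \<integral>\<^sup>+y. indicator A (x + (y + - x)) * indicator B (y + - x) \<partial>lborel \<partial>N)"
      using lborel_translation_nn[where f = "\<lambda>y. indicator A (x + y) * indicator B y" and a = "- x" for x]
      by simp
    also have "\<dots> = (\<integral>\<^sup>+x. \<integral>\<^sup>+y. indicator A y * indicator B (y - x) \<partial>lborel \<partial>N)"
      by simp
    also have "\<dots> = (\<integral>\<^sup>+y. \<integral>\<^sup>+x. indicator A y * indicator B (y - x) \<partial>N \<partial>lborel)"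
      by (rule Fubini'[symmetric]) measurable
    also have "\<dots> = (\<integral>\<^sup>+y. indicator A y * (\<integral>\<^sup>+x. indicator B (y - x) \<partial>N) \<partial>lborel)"
      by (intro nn_integral_cong, rule nn_integral_cmult) measurable
    also have "\<dots> = emeasure lborel A * b"
      by (simp add: reflN nn_integral_multc)
    finally show ?thesis using b by (metis ennreal_mult_cancel_left infinity_ennreal_def mult.commute)
  qed
  show ?thesis
    using eq by (intro measure_eqI) (auto simp: N_def)
qed

lemma norm_cis_scale: "norm (cis t *s w) = norm (w :: complex ^ 'n)"
  by (simp add: norm_vec_def norm_mult)

lemma linear_vector_scalar_mult: "linear (\<lambda>w :: complex ^ 'n. c *s w)"
  by (rule linearI) (auto simp: vec_eq_iff algebra_simps)

lemma continuous_on_vector_scalar_mult[continuous_intros]: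
  fixes f :: "'a::topological_space \<Rightarrow> complex" and g :: "'a \<Rightarrow> complex ^ 'n"
  assumes "continuous_on S f" "continuous_on S g"
  shows "continuous_on S (\<lambda>x. f x *s g x)"
  unfolding vector_scalar_mult_def
  by (intro continuous_on_vec_lambda continuous_intros assms)

lemma circle_submean_imp_ball_submean:
  fixes G :: "complex ^ 'n \<Rightarrow> real"
  assumes [measurable]: "G \<in> borel_measurable borel"
    and sm: "\<And>w. ennreal (2 * pi * G z) \<le> (\<integral>\<^sup>+t\<in>{0..2*pi}. ennreal (G (z + cis t *s w)) \<partial>lborel)"
  shows "ennreal (G z) * emeasure lborel (ball 0 R :: (complex ^ 'n) set)
    \<le> (\<integral>\<^sup>+w\<in>ball 0 R. ennreal (G (z + w)) \<partial>lborel)"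
proof -
  define B where "B = (ball 0 R :: (complex ^ 'n) set)"
  have [measurable]: "B \<in> sets borel" by (simp add: B_def)
  define I where "I = (\<integral>\<^sup>+w\<in>B. ennreal (G (z + w)) \<partial>lborel)"
  have [measurable]: "(\<lambda>w :: complex ^ 'n. cis t *s w) \<in> borel_measurable borel" for t
    by (intro borel_measurable_continuous_onI continuous_intros)
  have [measurable]: "(\<lambda>t. cis t *s w) \<in> borel_measurable borel" for w :: "complex ^ 'n"
    by (intro borel_measurable_continuous_onI continuous_intros)
  have [measurable]: "(\<lambda>p :: real \<times> (complex ^ 'n). cis (fst p) *s snd p) \<in> borel_measurable (borel \<Otimes>\<^sub>M borel)"
    unfolding borel_prod by (intro borel_measurable_continuous_onI continuous_intros)
  have [measurable]: "(\<lambda>p :: (complex ^ 'n) \<times> real. cis (snd p) *s fst p) \<in> borel_measurable (borel \<Otimes>\<^sub>M borel)"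
    unfolding borel_prod by (intro borel_measurable_continuous_onI continuous_intros)
  have rot: "I = (\<integral>\<^sup>+w\<in>B. ennreal (G (z + cis t *s w)) \<partial>lborel)" for t
  proof -
    have "I = (\<integral>\<^sup>+w\<in>B. ennreal (G (z + w)) \<partial>distr lborel borel (\<lambda>w. cis t *s w))"
      unfolding I_def by (subst lborel_distr_linear_isometry) (auto intro: linear_vector_scalar_mult norm_cis_scale)
    also have "\<dots> = (\<integral>\<^sup>+w\<in>B. ennreal (G (z + cis t *s w)) \<partial>lborel)"
      by (subst nn_integral_distr) (auto simp: B_def indicator_def norm_cis_scale intro!: nn_integral_cong)
    finally show ?thesis .
  qed
  have "ennreal (2 * pi) * (ennreal (G z) * emeasure lborel B)
      = (\<integral>\<^sup>+w\<in>B. ennreal (2 * pi * G z) \<partial>lborel)"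
    by (subst nn_integral_cmult_indicator) (auto simp: ennreal_mult' mult.assoc)
  also have "\<dots> \<le> (\<integral>\<^sup>+w\<in>B. (\<integral>\<^sup>+t\<in>{0..2*pi}. ennreal (G (z + cis t *s w)) \<partial>lborel) \<partial>lborel)"
    using sm by (intro nn_integral_mono mult_right_mono) auto
  also have "\<dots> = (\<integral>\<^sup>+w. (\<integral>\<^sup>+t. ennreal (G (z + cis t *s w)) * indicator {0..2*pi} t * indicator B w \<partial>lborel) \<partial>lborel)"
    by (subst nn_integral_multc) auto
  also have "\<dots> = (\<integral>\<^sup>+t. (\<integral>\<^sup>+w. ennreal (G (z + cis t *s w)) * indicator {0..2*pi} t * indicator B w \<partial>lborel) \<partial>lborel)"
    by (rule lborel_pair.Fubini') measurable
  also have "\<dots> = (\<integral>\<^sup>+t. (\<integral>\<^sup>+w\<in>B. ennreal (G (z + cis t *s w)) \<partial>lborel) * indicator {0..2*pi} t \<partial>lborel)"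
    by (subst nn_integral_multc[symmetric]) (auto simp: ac_simps)
  also have "\<dots> = ennreal (2 * pi) * I"
    by (subst rot[symmetric]) (simp add: nn_integral_cmult_indicator mult.commute)
  finally show ?thesis
    unfolding I_def[symmetric] B_def[symmetric] by (subst (asm) ennreal_mult_le_mult_iff) (use pi_gt_zero in \<open>auto simp: ennreal_eq_0_iff simp del: pi_gt_zero\<close>)
qed

subsection \<open>Functions vanishing off a set of zero density\<close>

lemma usc_borel_measurable:
  fixes G :: "'a::topological_space \<Rightarrow> real"
  assumes "\<And>a. open {z. G z < a}"
  shows "G \<in> borel_measurable borel"
  by (rule borel_measurableI_less) (use assms in simp)

lemma usc_bounded_above_on_compact:
  fixes G :: "'a::topological_space \<Rightarrow> real"
  assumes usc: "\<And>a. open {z. G z < a}" and "compact K"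
  obtains B where "B \<ge> 0" "\<And>z. z \<in> K \<Longrightarrow> G z \<le> B"
proof -
  have "K \<subseteq> (\<Union>n::nat. {z. G z < real n})" using reals_Archimedean2 by auto
  from compactE_image[OF \<open>compact K\<close> usc this]
  obtain C :: "nat set" where C: "finite C" "K \<subseteq> (\<Union>n\<in>C. {z. G z < real n})" by auto
  show ?thesis
  proof (rule that[of "real (Max (insert 0 C))"])
    fix z assume "z \<in> K"
    then obtain n where "n \<in> C" "G z < real n" using C by auto
    then show "G z \<le> real (Max (insert 0 C))"
      using Max_ge[of "insert 0 C" n] C(1) by (meson finite_insert insertI2 less_le_trans less_imp_le of_nat_le_iff)
  qed simp
qed

lemma growth_order_finiteD:
  fixes M :: "'a::real_normed_vector \<Rightarrow> ereal"
  assumes "growth_order M < \<infinity>"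
  obtains k :: nat and R where "R \<ge> 1" "\<And>z. norm z \<ge> R \<Longrightarrow> M z \<le> ereal (norm z ^ k)"
proof -
  obtain k :: nat where "growth_order M < ereal (real k)"
    using assms less_PInf_Ex_of_nat by auto
  then have "\<forall>\<^sub>F z in at_infinity. eln (1 + max 0 (M z)) / ereal (ln (norm z)) < ereal (real k)"
    unfolding growth_order_def by (rule Limsup_lessD)
  then obtain b where b: "\<And>z. norm z \<ge> b \<Longrightarrow> eln (1 + max 0 (M z)) / ereal (ln (norm z)) < ereal (real k)"
    unfolding eventually_at_infinity by auto
  show ?thesis
  proof (rule that[of "max b 2" k])
    fix z :: 'a assume z: "norm z \<ge> max b 2"
    define m where "m = max 0 (M z)"
    have "norm z > 0" using z by linarith
    then have "norm z ^ k > 0" by (rule zero_less_power)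
    have lnz: "ln (norm z) > 0" using z by (intro ln_gt_zero) simp
    have lt: "eln (1 + m) / ereal (ln (norm z)) < ereal (real k)"
      using b z by (simp add: m_def)
    have "m \<ge> 0" by (simp add: m_def)
    have "m \<noteq> \<infinity>" using lt lnz by (auto simp: eln_def)
    with \<open>m \<ge> 0\<close> obtain x where x: "m = ereal x" "x \<ge> 0" by (cases m) auto
    have "eln (1 + m) = ereal (ln (1 + x))"
      using x by (simp add: eln_def one_ereal_def)
    with lt lnz have "ln (1 + x) / ln (norm z) < real k" by (simp add: divide_ereal_def field_simps)
    then have "ln (1 + x) < ln (norm z ^ k)"
      using lnz z by (simp add: ln_realpow field_simps)
    then have "1 + x < norm z ^ k"
      using x \<open>norm z ^ k > 0\<close> by (subst (asm) ln_less_cancel_iff) auto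
    then have "ereal x \<le> ereal (norm z ^ k)" by simp
    moreover have "M z \<le> m" by (simp add: m_def)
    ultimately show "M z \<le> ereal (norm z ^ k)" using x by (metis order_trans)
  qed simp
qed

lemma zero_density_imp_zero:
  fixes G :: "complex ^ 'n \<Rightarrow> real"
  assumes usc: "\<And>a. open {z. G z < a}"
    and nonneg: "\<And>z. G z \<ge> 0" and off: "\<And>z. z \<notin> E \<Longrightarrow> G z = 0"
    and density: "has_relative_Lebesgue_density E 0"
    and sm: "\<And>z w. ennreal (2 * pi * G z) \<le> (\<integral>\<^sup>+t\<in>{0..2*pi}. ennreal (G (z + cis t *s w)) \<partial>lborel)"
    and growth: "\<And>z. norm z \<ge> R0 \<Longrightarrow> G z \<le> norm z ^ k"
  shows "G z = 0"
proof -
  note [measurable] = usc_borel_measurable[OF usc]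
  define D where "D = DIM(complex ^ 'n)"
  define V where "V = unit_ball_vol (real D)"
  have "V > 0" by (simp add: V_def)
  have E: "E \<in> sets lebesgue" and
    lim: "((\<lambda>r. measure lebesgue (E \<inter> ball 0 r) / r ^ D) \<longlongrightarrow> 0) at_top"
    using density unfolding has_relative_Lebesgue_density_def D_def by auto
  define \<eta> where "\<eta> = V / (2 ^ D * 2 ^ (k + 1))"
  have "\<eta> > 0" using \<open>V > 0\<close> by (simp add: \<eta>_def)
  from order_tendstoD(2)[OF lim this]
  obtain r1 where r1: "\<And>r. r \<ge> r1 \<Longrightarrow> measure lebesgue (E \<inter> ball 0 r) / r ^ D < \<eta>"
    unfolding eventually_at_top_linorder by auto
  define R1 where "R1 = max 1 r1"
  define P where "P = {z. G z > 0}"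
  have [measurable]: "P \<in> sets borel" unfolding P_def by measurable
  have "P \<subseteq> E" using off by (force simp: P_def)
  have halve: "G z \<le> K / 2 ^ (k + 1)"
    if R: "R \<ge> R1" and "K \<ge> 0" and K: "\<And>z. z \<in> cball 0 (2 * R) \<Longrightarrow> G z \<le> K" and z: "z \<in> cball 0 R" for R K z
  proof -
    have "R > 0" using R by (simp add: R1_def)
    define B where "B = (ball 0 (2 * R) :: (complex ^ 'n) set)"
    have [measurable]: "B \<in> sets borel" by (simp add: B_def)
    have mB: "measure lebesgue (E \<inter> B) \<le> \<eta> * (2 * R) ^ D"
      using r1[of "2 * R"] R \<open>R > 0\<close> by (simp add: R1_def B_def field_simps)
    have EB: "E \<inter> B \<in> lmeasurable"
      using E fmeasurable_Int_fmeasurable[OF lmeasurable_ball] by (simp add: B_def Int_commute)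
    have "ennreal (G z) * emeasure lborel (ball 0 R :: (complex ^ 'n) set)
        \<le> (\<integral>\<^sup>+w\<in>ball 0 R. ennreal (G (z + w)) \<partial>lborel)"
      using sm by (intro circle_submean_imp_ball_submean) auto
    also have "\<dots> \<le> (\<integral>\<^sup>+w. ennreal K * indicator (P \<inter> B) (w + z) \<partial>lborel)"
    proof (intro nn_integral_mono)
      fix w
      show "ennreal (G (z + w)) * indicator (ball 0 R) w \<le> ennreal K * indicator (P \<inter> B) (w + z)"
      proof (cases "w \<in> ball 0 R \<and> G (z + w) > 0")
        case True
        then have "norm (w + z) < 2 * R" using z norm_triangle_ineq[of w z] by simp
        with True K[of "z + w"] show ?thesis
          by (auto simp: P_def B_def add.commute intro: ennreal_leI)
      next
        case False
        then show ?thesis using nonneg[of "z + w"] by (auto simp: indicator_def not_less ennreal_neg)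
      qed
    qed
    also have "\<dots> = (\<integral>\<^sup>+w. ennreal K * indicator (P \<inter> B) w \<partial>lborel)"
      by (rule lborel_translation_nn[where f = "\<lambda>w. ennreal K * indicator (P \<inter> B) w"]) measurable
    also have "\<dots> = ennreal K * emeasure lborel (P \<inter> B)"
      by (subst nn_integral_cmult_indicator) auto
    also have "emeasure lborel (P \<inter> B) = emeasure lebesgue (P \<inter> B)" by simp
    also have "\<dots> \<le> emeasure lebesgue (E \<inter> B)"
      using \<open>P \<subseteq> E\<close> EB by (intro emeasure_mono) (auto simp: fmeasurable_def)
    also have "\<dots> = ennreal (measure lebesgue (E \<inter> B))"
      using EB by (simp add: emeasure_eq_measure2)
    also have "\<dots> \<le> ennreal (\<eta> * (2 * R) ^ D)" using mB by (rule ennreal_leI)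
    finally have "ennreal (G z) * ennreal (V * R ^ D) \<le> ennreal K * ennreal (\<eta> * (2 * R) ^ D)"
      using \<open>R > 0\<close> by (simp add: emeasure_ball V_def D_def mult_left_mono)
    then have "G z * (V * R ^ D) \<le> K * (\<eta> * (2 * R) ^ D)"
      using \<open>K \<ge> 0\<close> \<open>V > 0\<close> \<open>\<eta> > 0\<close> \<open>R > 0\<close> nonneg by (simp flip: ennreal_mult)
    also have "\<dots> = (K / 2 ^ (k + 1)) * (V * R ^ D)"
      by (simp add: \<eta>_def power_mult_distrib)
    finally show ?thesis
      using \<open>V > 0\<close> \<open>R > 0\<close> by (simp only: mult_le_cancel_right_pos mult_pos_pos zero_less_power)
  qed
  have iter: "G z \<le> K / (2 ^ (k + 1)) ^ j"
    if "R \<ge> R1" "K \<ge> 0" "\<And>z. z \<in> cball 0 (2 ^ j * R) \<Longrightarrow> G z \<le> K" "z \<in> cball 0 R" for R K z j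
    using that(2-4)
  proof (induction j arbitrary: K z)
    case (Suc j)
    have "2 ^ j * R \<ge> R1"
      using \<open>R \<ge> R1\<close> mult_mono[of 1 "2 ^ j" R1 R] by (simp add: R1_def)
    from halve[OF this \<open>K \<ge> 0\<close>] Suc.prems(2)
    have "\<And>z. z \<in> cball 0 (2 ^ j * R) \<Longrightarrow> G z \<le> K / 2 ^ (k + 1)" by (simp add: mult.assoc)
    from Suc.IH[OF _ this Suc.prems(3)] Suc.prems(1)
    show ?case by (simp add: field_simps)
  qed simp
  obtain A where A: "A \<ge> 0" "\<And>z. z \<in> cball 0 R0 \<Longrightarrow> G z \<le> A"
    using usc_bounded_above_on_compact[OF usc compact_cball, of 0 R0] by metis
  define R where "R = max R1 (norm z)"
  have "R \<ge> 1" by (simp add: R_def R1_def)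
  have le: "G z \<le> (A + R ^ k) * (1 / 2) ^ j" for j
  proof -
    have "G y \<le> A + (2 ^ j * R) ^ k" if "y \<in> cball 0 (2 ^ j * R)" for y
    proof (cases "norm y \<le> R0")
      case True
      then show ?thesis using A(2)[of y] \<open>R \<ge> 1\<close> by (simp add: add_increasing2)
    next
      case False
      then have "G y \<le> norm y ^ k" using growth by simp
      also have "\<dots> \<le> (2 ^ j * R) ^ k" using that by (intro power_mono) auto
      finally show ?thesis using A(1) by simp
    qed
    then have "G z \<le> (A + (2 ^ j * R) ^ k) / (2 ^ (k + 1)) ^ j"
      using A(1) \<open>R \<ge> 1\<close> by (intro iter[of R]) (auto simp: R_def)
    also have "\<dots> \<le> ((A + R ^ k) * (2 ^ k) ^ j) / (2 ^ (k + 1)) ^ j"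
    proof (rule divide_right_mono)
      have "A * 1 \<le> A * (2 ^ k) ^ j" using A(1) by (intro mult_left_mono) auto
      then show "A + (2 ^ j * R) ^ k \<le> (A + R ^ k) * (2 ^ k) ^ j"
        by (simp add: power_mult_distrib distrib_right mult.commute flip: power_mult)
    qed simp
    also have "\<dots> = (A + R ^ k) * (1 / 2) ^ j"
      by (simp add: power_add power_mult_distrib power_divide)
    finally show ?thesis .
  qed
  have "(\<lambda>j. (A + R ^ k) * (1 / 2) ^ j) \<longlonglongrightarrow> (A + R ^ k) * 0"
    by (intro tendsto_intros) simp
  then have "G z \<le> (A + R ^ k) * 0"
    using le by (intro LIMSEQ_le_const) auto
  with nonneg[of z] show ?thesis by simp
qed

subsection \<open>Circle means of the logarithm of the modulus\<close>

lemma integral_periodic_interval: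
  fixes \<phi> :: "real \<Rightarrow> real"
  assumes cont: "continuous_on UNIV \<phi>" and per: "\<And>t. \<phi> (t + p) = \<phi> t"
    and "0 \<le> a" "a \<le> p"
  shows "integral {a..a + p} \<phi> = integral {0..p} \<phi>"
proof -
  have int: "\<phi> integrable_on {x..y}" for x y
    by (intro integrable_continuous_real continuous_on_subset[OF cont]) auto
  have "integral {a..a + p} \<phi> = integral {a..p} \<phi> + integral {p..a + p} \<phi>"
    using assms by (subst Henstock_Kurzweil_Integration.integral_combine[OF _ _ int]) auto
  also have "integral {p..a + p} \<phi> = integral {0..a} \<phi>"
    using integral_shift_Icc_real[of 0 a \<phi> p] per by (simp add: o_def add.commute)
  also have "integral {a..p} \<phi> + integral {0..a} \<phi> = integral {0..p} \<phi>"
    using assms by (subst add.commute, subst Henstock_Kurzweil_Integration.integral_combine[OF _ _ int]) auto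
  finally show ?thesis .
qed

lemma Riemann_sum_le_integral:
  fixes \<phi> :: "real \<Rightarrow> real"
  assumes cont: "continuous_on UNIV \<phi>" and "0 \<le> d" "0 \<le> a"
    and close: "\<And>x y. 0 \<le> x \<Longrightarrow> x \<le> y \<Longrightarrow> y \<le> x + d \<Longrightarrow> y \<le> a + real N * d \<Longrightarrow> \<phi> x \<le> \<phi> y + e"
  shows "k \<le> N \<Longrightarrow> (\<Sum>j<k. d * \<phi> (a + real j * d))
    \<le> integral {a..a + real k * d} \<phi> + real k * d * e"
proof (induction k)
  case (Suc k)
  define b where "b = a + real k * d"
  have int: "\<phi> integrable_on {x..y}" for x y
    by (intro integrable_continuous_real continuous_on_subset[OF cont]) auto
  have b: "0 \<le> b" "a \<le> b" using assms by (auto simp: b_def)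
  have bd: "a + real (Suc k) * d = b + d" by (simp add: b_def algebra_simps)
  have "b + d \<le> a + real N * d"
    using Suc.prems \<open>0 \<le> d\<close> unfolding bd[symmetric] by (intro add_left_mono mult_right_mono) auto
  then have "d * (\<phi> b - e) \<le> integral {b..b + d} \<phi>"
    using integral_le[of "\<lambda>_. \<phi> b - e" "{b..b+d}" \<phi>] int close[OF b(1)] \<open>0 \<le> d\<close>
    by (force simp: diff_le_eq)
  moreover have "integral {a..b} \<phi> + integral {b..b + d} \<phi> = integral {a..b + d} \<phi>"
    using b assms by (intro Henstock_Kurzweil_Integration.integral_combine int) auto
  moreover have "(\<Sum>j<k. d * \<phi> (a + real j * d)) \<le> integral {a..b} \<phi> + real k * d * e"
    unfolding b_def using Suc by simp
  ultimately show ?case unfolding bd by (simp add: b_def algebra_simps)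
qed (simp add: assms)

text \<open>Jensen's inequality without a factorisation of \<open>g\<close>: the maximum principle for
  \<open>\<Prod>j<N. g (c + z \<omega>\<^sup>j)\<close>, \<open>\<omega> = cis (2 \<pi> / N)\<close>, bounds \<open>N ln |g c|\<close> by \<open>N\<close> times a
  Riemann sum of \<open>\<phi>\<close>.\<close>

lemma log_modulus_circle_mean:
  fixes g :: "complex \<Rightarrow> complex" and \<phi> :: "real \<Rightarrow> real"
  assumes "open S" "cball c r \<subseteq> S" "0 < r" and hol: "g holomorphic_on S"
    and cont: "continuous_on UNIV \<phi>" and per: "\<And>t. \<phi> (t + 2 * pi) = \<phi> t"
    and bound: "\<And>t. cmod (g (c + of_real r * cis t)) \<le> exp (\<phi> t)"
    and lower: "exp m \<le> cmod (g c)"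
  shows "2 * pi * m \<le> integral {0..2 * pi} \<phi>"
proof (rule field_le_epsilon)
  fix e' :: real assume "0 < e'"
  define e where "e = e' / (2 * pi)"
  have "e > 0" using \<open>0 < e'\<close> by (simp add: e_def)
  have "uniformly_continuous_on {0..4 * pi} \<phi>"
    by (intro compact_uniformly_continuous continuous_on_subset[OF cont]) auto
  then obtain \<delta> where "\<delta> > 0" and \<delta>: "\<And>x y. x \<in> {0..4*pi} \<Longrightarrow> y \<in> {0..4*pi} \<Longrightarrow> \<bar>x - y\<bar> < \<delta> \<Longrightarrow> \<bar>\<phi> x - \<phi> y\<bar> < e"
    using \<open>e > 0\<close> unfolding uniformly_continuous_on_def dist_real_def by metis
  obtain N :: nat where N: "2 * pi / \<delta> < real N" using reals_Archimedean2 by blast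
  with \<open>\<delta> > 0\<close> have "N > 0" using pi_gt_zero by (metis divide_pos_pos less_trans mult_2 add_pos_pos of_nat_0_less_iff)
  define d where "d = 2 * pi / real N"
  have d: "0 < d" "d < \<delta>" "real N * d = 2 * pi"
    using N \<open>N > 0\<close> \<open>\<delta> > 0\<close> by (auto simp: d_def field_simps)
  define J where "J = integral {0..2*pi} \<phi>"
  have sum_le: "(\<Sum>j<N. \<phi> (a + real j * d)) \<le> real N * ((J + e') / (2 * pi))" if a: "0 \<le> a" "a \<le> 2 * pi" for a
  proof -
    have "\<phi> x \<le> \<phi> y + e" if "0 \<le> x" "x \<le> y" "y \<le> x + d" "y \<le> a + real N * d" for x y
      using \<delta>[of x y] that d a by (simp add: abs_less_iff)
    then have "(\<Sum>j<N. d * \<phi> (a + real j * d)) \<le> integral {a..a + real N * d} \<phi> + real N * d * e"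
      by (intro Riemann_sum_le_integral[OF cont _ a(1)]) (use d in auto)
    with d
    have "(\<Sum>j<N. d * \<phi> (a + real j * d)) \<le> integral {a..a + 2 * pi} \<phi> + 2 * pi * e"
      by simp
    also have "\<dots> = J + e'"
      using integral_periodic_interval[OF cont per a] by (simp add: J_def e_def)
    finally have "d * (\<Sum>j<N. \<phi> (a + real j * d)) \<le> J + e'" by (simp add: sum_distrib_left)
    then show ?thesis using \<open>N > 0\<close> by (simp add: d_def field_simps)
  qed
  define F where "F z = (\<Prod>j<N. g (c + z * cis (real j * d)))" for z
  have sub: "(\<lambda>z. c + z * cis (real j * d)) ` cball 0 r \<subseteq> S" for j
    using assms(2) by (auto simp: dist_norm norm_mult)
  have holF: "F holomorphic_on ball 0 r" and contF: "continuous_on (cball 0 r) F"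
  proof -
    have "(g \<circ> (\<lambda>z. c + z * cis (real j * d))) holomorphic_on ball 0 r" for j
      using sub[of j] ball_subset_cball[of "0::complex" r]
      by (intro holomorphic_on_compose_gen[OF _ hol] holomorphic_intros) auto
    then show "F holomorphic_on ball 0 r"
      unfolding F_def o_def by (intro holomorphic_intros) auto
    show "continuous_on (cball 0 r) F"
      unfolding F_def using sub
      by (intro continuous_intros continuous_on_compose2[OF holomorphic_on_imp_continuous_on[OF hol]]) auto
  qed
  have "norm (F 0) \<le> exp (real N * ((J + e') / (2 * pi)))"
  proof (rule maximum_modulus_frontier[where S = "cball 0 r" and f = F and \<xi> = 0])
    fix z :: complex assume "z \<in> frontier (cball 0 r)"
    then have "norm z = r" by simp
    obtain \<theta> where \<theta>: "0 \<le> \<theta>" "\<theta> < 2 * pi" "z = of_real r * cis \<theta>"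
      using \<open>norm z = r\<close> by (metis rcis_def Arg2pi_ge_0 Arg2pi_lt_2pi Arg2pi_eq cis_conv_exp)
    have "norm (F z) = (\<Prod>j<N. cmod (g (c + of_real r * cis (\<theta> + real j * d))))"
      by (simp add: F_def \<theta>(3) prod_norm[symmetric] cis_mult mult.assoc)
    also have "\<dots> \<le> (\<Prod>j<N. exp (\<phi> (\<theta> + real j * d)))"
      by (intro prod_mono) (use bound in auto)
    also have "\<dots> = exp (\<Sum>j<N. \<phi> (\<theta> + real j * d))" by (simp add: exp_sum)
    also have "\<dots> \<le> exp (real N * ((J + e') / (2 * pi)))"
      using sum_le \<theta> by simp
    finally show "norm (F z) \<le> exp (real N * ((J + e') / (2 * pi)))" .
  qed (use holF contF \<open>0 < r\<close> in auto)
  moreover have "norm (F 0) = norm (g c) ^ N" by (simp add: F_def norm_power)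
  moreover have "exp (real N * m) \<le> norm (g c) ^ N"
    using power_mono[OF lower, of N] by (simp add: exp_of_nat_mult)
  ultimately have "exp (real N * m) \<le> exp (real N * ((J + e') / (2 * pi)))" by linarith
  then have "m \<le> (J + e') / (2 * pi)"
    using \<open>N > 0\<close> by (simp only: exp_le_cancel_iff mult_le_cancel_left_pos of_nat_0_less_iff)
  then show "2 * pi * m \<le> integral {0..2 * pi} \<phi> + e'"
    by (simp add: J_def field_simps)
qed

lemma ln_norm_circle_mean_le:
  fixes c :: complex
  assumes r: "0 < r" "r < norm c"
  shows "integral {0..2*pi} (\<lambda>t. ln (norm (c + of_real r * cis t))) \<le> 2 * pi * ln (norm c)"
proof -
  have nz: "c + of_real r * cis t \<noteq> 0" for t
  proof
    assume "c + of_real r * cis t = 0"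
    then have "norm c = norm (of_real r * cis t)" by (metis add_eq_0_iff norm_minus_cancel)
    with r show False by (simp add: norm_mult)
  qed
  have "2 * pi * (- ln (norm c)) \<le> integral {0..2*pi} (\<lambda>t. - ln (norm (c + of_real r * cis t)))"
  proof (rule log_modulus_circle_mean[where g = inverse and S = "- {0}" and c = c and r = r])
    show "cball c r \<subseteq> - {0}" using r by (auto simp: dist_norm)
    show "continuous_on UNIV (\<lambda>t. - ln (norm (c + of_real r * cis t)))"
      using nz by (intro continuous_intros) auto
    show "cmod (inverse (c + of_real r * cis t)) \<le> exp (- ln (norm (c + of_real r * cis t)))" for t
      using nz by (simp add: exp_minus norm_inverse)
    show "exp (- ln (norm c)) \<le> cmod (inverse c)"
      using r by (subst exp_minus, subst exp_ln) (auto simp: norm_inverse)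
  qed (use r in \<open>auto intro!: holomorphic_intros simp: cis_mult[symmetric]\<close>)
  then show ?thesis by simp
qed

subsection \<open>Liouville's theorem for submean functions\<close>

definition circle_submean :: "(complex \<Rightarrow> real) \<Rightarrow> bool" where
  "circle_submean W \<longleftrightarrow>
     (\<forall>c. \<forall>r>0. 2 * pi * W c \<le> (LINT t:{0..2*pi}|lborel. W (c + of_real r * cis t)))"

lemma bounded_borel_set_integrable:
  fixes \<phi> :: "real \<Rightarrow> real"
  assumes [measurable]: "\<phi> \<in> borel_measurable borel"
    and "\<And>t. t \<in> {a..b} \<Longrightarrow> A \<le> \<phi> t" "\<And>t. t \<in> {a..b} \<Longrightarrow> \<phi> t \<le> B"
  shows "set_integrable lborel {a..b} \<phi>"
  unfolding set_integrable_def
proof (rule integrableI_bounded_set[where A = "{a..b}" and B = "max \<bar>A\<bar> \<bar>B\<bar>"])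
  show "AE t in lborel. t \<in> {a..b} \<longrightarrow> norm (indicator {a..b} t *\<^sub>R \<phi> t) \<le> max \<bar>A\<bar> \<bar>B\<bar>"
    using assms by (fastforce intro!: AE_I2)
qed (auto simp: indicator_def emeasure_lborel_Icc_eq)

lemma nn_integral_eq_set_integral:
  fixes \<phi> :: "real \<Rightarrow> real"
  assumes "set_integrable lborel A \<phi>" "\<And>t. t \<in> A \<Longrightarrow> 0 \<le> \<phi> t"
  shows "(\<integral>\<^sup>+t\<in>A. ennreal (\<phi> t) \<partial>lborel) = ennreal (LINT t:A|lborel. \<phi> t)"
proof -
  have "(\<integral>\<^sup>+t\<in>A. ennreal (\<phi> t) \<partial>lborel) = (\<integral>\<^sup>+t. ennreal (indicator A t *\<^sub>R \<phi> t) \<partial>lborel)"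
    by (intro nn_integral_cong) (auto simp: indicator_def)
  also have "\<dots> = ennreal (LINT t:A|lborel. \<phi> t)"
    unfolding set_lebesgue_integral_def
    using assms by (intro nn_integral_eq_integral) (auto simp: set_integrable_def indicator_def)
  finally show ?thesis .
qed

lemma usc_integral_eq_max_imp_const:
  fixes \<phi> :: "real \<Rightarrow> real"
  assumes usc: "\<And>a. open {t. \<phi> t < a}" and "a < b"
    and le: "\<And>t. t \<in> {a..b} \<Longrightarrow> \<phi> t \<le> \<mu>" and ge: "\<And>t. t \<in> {a..b} \<Longrightarrow> A \<le> \<phi> t"
    and int: "(b - a) * \<mu> \<le> (LINT t:{a..b}|lborel. \<phi> t)"
    and s: "s \<in> {a..b}"
  shows "\<phi> s = \<mu>"
proof (rule ccontr)
  assume "\<phi> s \<noteq> \<mu>"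
  with le s have "\<phi> s < \<mu>" by (simp add: order_less_le)
  have [measurable]: "\<phi> \<in> borel_measurable borel" by (rule usc_borel_measurable[OF usc])
  have int\<phi>: "set_integrable lborel {a..b} \<phi>"
    by (rule bounded_borel_set_integrable) (use le ge in auto)
  have intc: "set_integrable lborel {a..b} (\<lambda>_. \<mu>)"
    by (rule bounded_borel_set_integrable) auto
  let ?f = "\<lambda>t. indicator {a..b} t *\<^sub>R (\<mu> - \<phi> t)"
  have intf: "integrable lborel ?f"
    using set_integral_diff(1)[OF intc int\<phi>] unfolding set_integrable_def .
  have "integral\<^sup>L lborel ?f = (LINT t:{a..b}|lborel. \<mu>) - (LINT t:{a..b}|lborel. \<phi> t)"
    using set_integral_diff(2)[OF intc int\<phi>] unfolding set_lebesgue_integral_def .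
  also have "\<dots> \<le> 0" using int \<open>a < b\<close> by (simp add: set_lebesgue_integral_def)
  finally have "integral\<^sup>L lborel ?f \<le> 0" .
  moreover have pos: "0 \<le> ?f t" for t using le by (auto simp: indicator_def)
  ultimately have "integral\<^sup>L lborel ?f = 0" by (meson Bochner_Integration.integral_nonneg antisym)
  then have ae: "AE t in lborel. ?f t = 0"
    using integral_nonneg_eq_0_iff_AE[OF intf] pos by simp
  define U where "U = {t. \<phi> t < \<mu>} \<inter> {a<..<b}"
  have "open U" unfolding U_def using usc by auto
  have "s \<in> {t. \<phi> t < \<mu>} \<inter> closure {a<..<b}" using s \<open>\<phi> s < \<mu>\<close> \<open>a < b\<close> by simp
  then have "U \<noteq> {}" unfolding U_def using open_Int_closure_eq_empty[OF usc] by blast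
  have "AE t in lborel. t \<notin> U"
    using ae by eventually_elim (auto simp: U_def)
  then have "U \<in> null_sets lborel" using \<open>open U\<close> by (subst (asm) AE_iff_null_sets[symmetric]) auto
  then have "negligible U" by (simp add: negligible_iff_null_sets null_sets_completionI)
  with \<open>open U\<close> \<open>U \<noteq> {}\<close> show False using open_not_negligible by blast
qed

lemma usc_attains_max_on_compact:
  fixes G :: "'a::topological_space \<Rightarrow> real"
  assumes usc: "\<And>a. open {z. G z < a}" and "compact K" "K \<noteq> {}"
  obtains p where "p \<in> K" "\<And>z. z \<in> K \<Longrightarrow> G z \<le> G p"
proof (rule ccontr)
  assume "\<not> thesis"
  then have ex: "\<And>p. p \<in> K \<Longrightarrow> \<exists>z\<in>K. G p < G z" using that by (meson not_less)
  then have "K \<subseteq> (\<Union>z\<in>K. {y. G y < G z})" by auto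
  from compactE_image[OF \<open>compact K\<close> usc this]
  obtain C where C: "C \<subseteq> K" "finite C" "K \<subseteq> (\<Union>z\<in>C. {y. G y < G z})" by auto
  have "C \<noteq> {}" using C \<open>K \<noteq> {}\<close> by auto
  then have "Max (G ` C) \<in> G ` C" using C by (intro Max_in) auto
  then obtain p where p: "p \<in> C" "G p = Max (G ` C)" by auto
  then obtain z where "z \<in> C" "G p < G z" using C by blast
  moreover have "G z \<le> Max (G ` C)" using C \<open>z \<in> C\<close> by simp
  ultimately show False using p by simp
qed

lemma usc_compose_continuous:
  fixes G :: "'a::topological_space \<Rightarrow> real"
  assumes "\<And>a. open {z. G z < a}" "continuous_on UNIV h"
  shows "open {t. G (h t) < a}"
  using open_vimage[OF assms(1) assms(2), of a] by (simp add: vimage_def)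

lemma usc_compose_set_integrable:
  fixes G :: "'a::topological_space \<Rightarrow> real" and h :: "real \<Rightarrow> 'a"
  assumes "\<And>a. open {z. G z < a}" "continuous_on UNIV h"
    and "\<And>t. t \<in> {a..b} \<Longrightarrow> A \<le> G (h t)" "\<And>t. t \<in> {a..b} \<Longrightarrow> G (h t) \<le> B"
  shows "set_integrable lborel {a..b} (\<lambda>t. G (h t))"
  by (rule bounded_borel_set_integrable[OF
        usc_borel_measurable[OF usc_compose_continuous[OF assms(1,2)]] assms(3,4)])

lemma usc_diff_continuous:
  fixes G L :: "'a::topological_space \<Rightarrow> real"
  assumes usc: "\<And>a. open {z. G z < a}" and cont: "continuous_on UNIV L"
  shows "open {z. G z - L z < a}"
proof -
  have "{z. G z - L z < a} = (\<Union>q. {z. G z < q} \<inter> {z. q - a < L z})"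
  proof (intro set_eqI iffI)
    fix z assume "z \<in> {z. G z - L z < a}"
    then have "G z < (G z + a + L z) / 2 \<and> (G z + a + L z) / 2 - a < L z" by (simp add: field_simps)
    then show "z \<in> (\<Union>q. {z. G z < q} \<inter> {z. q - a < L z})" by blast
  qed auto
  moreover have "open {z. q - a < L z}" for q
    by (intro open_Collect_less cont continuous_intros)
  ultimately show ?thesis using usc by (simp add: open_UN open_Int)
qed

lemma continuous_on_circle[continuous_intros]: "continuous_on S (\<lambda>t. c + of_real r * cis t)"
  by (intro continuous_intros)

text \<open>Comparing with \<open>\<epsilon> ln |z|\<close> shows that the maximum over the closed unit disc is global; it is
  then attained on every circle around the maximum point.\<close>

lemma circle_submean_Liouville:
  fixes W :: "complex \<Rightarrow> real"
  assumes usc: "\<And>a. open {z. W z < a}" and sm: "circle_submean W"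
    and ge: "\<And>z. A \<le> W z" and le: "\<And>z. W z \<le> B"
  shows "W constant_on UNIV"
proof -
  have smD: "2 * pi * W c \<le> (LINT t:{0..2*pi}|lborel. W (c + of_real r * cis t))" if "r > 0" for c r
    using sm that by (auto simp: circle_submean_def)
  obtain p where p: "\<And>z. z \<in> cball 0 1 \<Longrightarrow> W z \<le> W p"
    by (rule usc_attains_max_on_compact[OF usc compact_cball, of 0 1]) auto
  have glob: "W z0 \<le> W p" for z0
  proof (rule ccontr)
    assume less: "\<not> W z0 \<le> W p"
    then have "norm z0 > 1" using p[of z0] by force
    define L where "L z = ln (max 1 (norm z))" for z :: complex
    have contL: "continuous_on S L" for S unfolding L_def by (intro continuous_intros) auto
    have "L z0 > 0" using ln_gt_zero[OF \<open>norm z0 > 1\<close>] \<open>norm z0 > 1\<close> by (simp add: L_def)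
    define \<epsilon> where "\<epsilon> = (W z0 - W p) / (2 * L z0)"
    have "\<epsilon> > 0" using less \<open>L z0 > 0\<close> by (simp add: \<epsilon>_def)
    define H where "H z = W z - \<epsilon> * L z" for z
    have uscH: "open {z. H z < a}" for a
      unfolding H_def by (intro usc_diff_continuous usc continuous_intros contL)
    have "H z0 > W p"
    proof -
      have "\<epsilon> * L z0 = (W z0 - W p) / 2" using \<open>L z0 > 0\<close> by (simp add: \<epsilon>_def)
      with less show ?thesis unfolding H_def by (simp add: field_simps)
    qed
    define R where "R = max (norm z0 + 1) (exp ((B - W p) / \<epsilon> + 1))"
    have "R > norm z0" "R > 1" using \<open>norm z0 > 1\<close> by (auto simp: R_def)
    have big: "H z < W p" if "norm z = R" for z
    proof -
      have "exp ((B - W p) / \<epsilon> + 1) \<le> R" by (simp add: R_def)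
      then have "(B - W p) / \<epsilon> + 1 \<le> ln R" using \<open>R > 1\<close> by (simp add: ln_ge_iff)
      then have "(B - W p) / \<epsilon> < ln R" by simp
      then have "B - W p < \<epsilon> * ln R" using \<open>\<epsilon> > 0\<close> by (simp add: field_simps)
      then show ?thesis using le[of z] that \<open>R > 1\<close> by (simp add: H_def L_def)
    qed
    obtain q where q: "q \<in> cball 0 R" "\<And>z. z \<in> cball 0 R \<Longrightarrow> H z \<le> H q"
      by (rule usc_attains_max_on_compact[OF uscH compact_cball, of 0 R]) (use \<open>R > 1\<close> in auto)
    define \<mu> where "\<mu> = H q"
    have "\<mu> > W p" using q(2)[of z0] \<open>H z0 > W p\<close> \<open>R > norm z0\<close> by (simp add: \<mu>_def)
    define S where "S = cball 0 R \<inter> - {z. H z < \<mu>}"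
    have "compact S" unfolding S_def using uscH by (intro compact_Int_closed) auto
    moreover have "S \<noteq> {}" using q by (auto simp: S_def \<mu>_def)
    ultimately obtain c where c: "c \<in> S" "\<And>z. z \<in> S \<Longrightarrow> norm z \<le> norm c"
      using continuous_attains_sup[of S norm] by (auto intro: continuous_intros)
    have Hc: "H c = \<mu>" using c(1) q(2)[of c] by (auto simp: S_def \<mu>_def)
    have "norm c > 1"
      using p[of c] Hc \<open>\<mu> > W p\<close> by (cases "norm c \<le> 1") (auto simp: H_def L_def)
    have "norm c < R"
      using big[of c] Hc \<open>\<mu> > W p\<close> c(1) by (cases "norm c = R") (auto simp: S_def)
    define r where "r = min (norm c - 1) (R - norm c) / 2"
    have r: "0 < r" "1 < norm c - r" "norm c + r < R"
      using \<open>norm c > 1\<close> \<open>norm c < R\<close> by (auto simp: r_def min_def field_simps)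
    define h where "h t = c + of_real r * cis t" for t
    have contH: "continuous_on T h" for T unfolding h_def by (intro continuous_intros)
    have hn: "norm c - r \<le> norm (h t)" "norm (h t) \<le> norm c + r" for t
      using norm_diff_ineq[of c "of_real r * cis t"] norm_triangle_ineq[of c "of_real r * cis t"] r
      by (auto simp: h_def norm_mult)
    have intW: "set_integrable lborel {0..2*pi} (\<lambda>t. W (h t))"
      by (rule usc_compose_set_integrable[OF usc contH ge le])
    have contLh: "continuous_on T (\<lambda>t. L (h t))" for T
      by (rule continuous_on_compose2[OF contL[of UNIV] contH]) auto
    have intL: "set_integrable lborel {0..2*pi} (\<lambda>t. L (h t))"
      using contLh by (rule borel_integrable_atLeastAtMost')
    have "(LINT t:{0..2*pi}|lborel. L (h t)) = integral {0..2*pi} (\<lambda>t. L (h t))"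
      by (rule set_borel_integral_eq_integral(2)[OF intL])
    also have "\<dots> = integral {0..2*pi} (\<lambda>t. ln (norm (h t)))"
      using hn(1) r(2) by (intro integral_cong) (simp add: L_def max_absorb2 order_trans[OF less_imp_le])
    also have "\<dots> \<le> 2 * pi * L c"
      unfolding h_def using ln_norm_circle_mean_le[of r c] r \<open>norm c > 1\<close> by (simp add: L_def)
    finally have "\<epsilon> * (LINT t:{0..2*pi}|lborel. L (h t)) \<le> \<epsilon> * (2 * pi * L c)"
      using \<open>\<epsilon> > 0\<close> by (intro mult_left_mono) auto
    then have mean: "(2 * pi - 0) * \<mu> \<le> (LINT t:{0..2*pi}|lborel. H (h t))"
      using smD[OF r(1), of c] intW intL
      unfolding H_def by (simp add: set_integral_diff set_integral_mult_right Hc[symmetric] H_def h_def algebra_simps)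
    have hH: "H (h t) \<le> \<mu>" for t
      using q(2)[of "h t"] hn(2)[of t] r by (simp add: \<mu>_def)
    have "H (h s) = \<mu>" if "s \<in> {0..2*pi}" for s
    proof (rule usc_integral_eq_max_imp_const[OF _ _ _ _ mean that])
      show "open {t. H (h t) < a}" for a by (rule usc_compose_continuous[OF uscH contH])
      show "A - \<epsilon> * ln R \<le> H (h t)" for t
      proof -
        have "L (h t) \<le> ln R" unfolding L_def using hn[of t] r \<open>R > 1\<close> by (subst ln_le_cancel_iff) auto
        then have "\<epsilon> * L (h t) \<le> \<epsilon> * ln R" using \<open>\<epsilon> > 0\<close> by (intro mult_left_mono) auto
        with ge[of "h t"] show ?thesis by (simp add: H_def)
      qed
    qed (auto simp: hH)
    moreover define s where "s = Arg2pi c"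
    moreover have s: "s \<in> {0..2*pi}" using Arg2pi_ge_0[of c] Arg2pi_lt_2pi[of c] by (simp add: s_def)
    moreover have "norm (h s) = norm c + r"
    proof -
      have "h s = of_real (norm c + r) * cis s"
        using Arg2pi_eq[of c] by (simp add: h_def s_def cis_conv_exp algebra_simps)
      then show ?thesis using r by (simp add: norm_mult del: of_real_add)
    qed
    ultimately show False using c(2)[of "h s"] r by (simp add: S_def)
  qed
  have "W z = W p" for z
  proof (cases "z = p")
    case False
    define r where "r = norm (z - p)"
    have "r > 0" using False by (simp add: r_def)
    define s where "s = Arg2pi (z - p)"
    have s: "s \<in> {0..2*pi}" using Arg2pi_ge_0[of "z - p"] Arg2pi_lt_2pi[of "z - p"] by (simp add: s_def)
    have z: "p + of_real r * cis s = z"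
      using Arg2pi_eq[of "z - p"] by (simp add: r_def s_def cis_conv_exp)
    have "W (p + of_real r * cis s) = W p"
      by (rule usc_integral_eq_max_imp_const[OF usc_compose_continuous[OF usc continuous_on_circle] _ glob ge _ s])
        (use smD[OF \<open>r > 0\<close>, of p] in auto)
    with z show ?thesis by simp
  qed simp
  then show ?thesis by (auto simp: constant_on_def)
qed

subsection \<open>Plurisubharmonic and entire functions\<close>

lemma truncation_usc:
  fixes v :: "'a::topological_space \<Rightarrow> ereal"
  assumes "upper_semicontinuous v" "\<And>z. v z < \<infinity>"
  shows "open {z. real_of_ereal (max (v z) (ereal a)) < b}"
proof -
  have "real_of_ereal (max (v z) (ereal a)) < b \<longleftrightarrow> v z < ereal b \<and> a < b" for z
    using assms(2)[of z] by (cases "v z") (auto simp: max_def)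
  then show ?thesis using assms(1) by (cases "a < b") (auto simp: upper_semicontinuous_def)
qed

lemma subharmonic_truncation_circle_submean:
  assumes sh: "subharmonic v"
  shows "circle_submean (\<lambda>z. real_of_ereal (max (v z) (ereal a)))" (is "circle_submean ?W")
  unfolding circle_submean_def
proof (intro allI impI)
  fix c :: complex and r :: real assume "r > 0"
  define W where "W = ?W"
  have fin: "v z < \<infinity>" and usc: "upper_semicontinuous v" and mean: "v c \<le> circle_mean v c r" for z
    using sh \<open>r > 0\<close> by (auto simp: subharmonic_def)
  have uscW: "open {z. W z < b}" for b
    unfolding W_def using truncation_usc[OF usc fin] .
  have Weq: "ereal (W z) = max (v z) (ereal a)" for z
    using fin[of z] by (cases "v z") (auto simp: W_def max_def)
  then have vW: "v z \<le> ereal (W z)" and aW: "a \<le> W z" for z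
    by (metis max.cobounded1, metis max.cobounded2 ereal_less_eq(3))
  define h where "h t = c + of_real r * cis t" for t
  have conth: "continuous_on T h" for T unfolding h_def by (intro continuous_intros)
  have "compact (h ` {0..2*pi})" by (intro compact_continuous_image conth) simp
  then obtain B where "\<And>z. z \<in> h ` {0..2*pi} \<Longrightarrow> W z \<le> B"
    using usc_bounded_above_on_compact[OF uscW] by metis
  then have int: "set_integrable lborel {0..2*pi} (\<lambda>t. W (h t))"
    by (intro usc_compose_set_integrable[OF uscW conth aW, where B = B]) auto
  have "2 * pi * W c \<le> (LINT t:{0..2*pi}|lborel. W (h t))"
  proof (cases "v c \<le> ereal a")
    case True
    then have "W c = a" by (simp add: W_def max_def)
    then have "2 * pi * W c = (LINT t:{0..2*pi}|lborel. a)" by (simp add: set_lebesgue_integral_def)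
    also have "\<dots> \<le> (LINT t:{0..2*pi}|lborel. W (h t))"
      using aW by (intro set_integral_mono int bounded_borel_set_integrable[where A = a and B = a]) auto
    finally show ?thesis .
  next
    case False
    then have vc: "v c = ereal (W c)" using Weq[of c] by (simp add: max_def)
    define f where "f t = indicator {0..2*pi} t *\<^sub>R W (h t)" for t
    define P where "P = (\<integral>\<^sup>+t\<in>{0..2*pi}. e2ennreal (v (h t)) \<partial>lborel)"
    define Q where "Q = (\<integral>\<^sup>+t\<in>{0..2*pi}. e2ennreal (- v (h t)) \<partial>lborel)"
    have intf: "integrable lborel f" using int unfolding set_integrable_def f_def .
    define p where "p = enn2real (\<integral>\<^sup>+t. ennreal (f t) \<partial>lborel)"
    define q where "q = enn2real (\<integral>\<^sup>+t. ennreal (- f t) \<partial>lborel)"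
    have p: "(\<integral>\<^sup>+t. ennreal (f t) \<partial>lborel) = ennreal p" "p \<ge> 0"
      and q: "(\<integral>\<^sup>+t. ennreal (- f t) \<partial>lborel) = ennreal q" "q \<ge> 0"
      using intf unfolding real_integrable_def p_def q_def by (auto simp: less_top)
    have "P \<le> ennreal p"
      unfolding P_def p(1)[symmetric] f_def
    proof (intro nn_integral_mono)
      fix t
      show "e2ennreal (v (h t)) * indicator {0..2*pi} t \<le> ennreal (indicator {0..2*pi} t *\<^sub>R W (h t))"
        using e2ennreal_mono[OF vW[of "h t"]] by (simp add: indicator_def)
    qed
    moreover have "ennreal q \<le> Q"
      unfolding Q_def q(1)[symmetric] f_def
    proof (intro nn_integral_mono)
      fix t
      have "ereal (- W (h t)) \<le> - v (h t)" using vW[of "h t"] ereal_minus_le_minus by fastforce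
      from e2ennreal_mono[OF this]
      show "ennreal (- (indicator {0..2*pi} t *\<^sub>R W (h t))) \<le> e2ennreal (- v (h t)) * indicator {0..2*pi} t"
        by (simp add: indicator_def)
    qed
    moreover have mean': "ereal (W c) \<le> (enn2ereal P - enn2ereal Q) / ereal (2 * pi)"
      using mean unfolding circle_mean_def vc[symmetric] P_def Q_def h_def .
    ultimately have "2 * pi * W c \<le> p - q"
    proof -
      assume PQ: "P \<le> ennreal p" "ennreal q \<le> Q"
      have "enn2ereal P \<le> ereal p" "ereal q \<le> enn2ereal Q"
        using PQ p(2) q(2) by (metis enn2ereal_ennreal less_eq_ennreal.rep_eq)+
      then have "enn2ereal P - enn2ereal Q \<le> ereal p - ereal q" by (rule ereal_minus_mono)
      then have "(enn2ereal P - enn2ereal Q) / ereal (2 * pi) \<le> (ereal p - ereal q) / ereal (2 * pi)"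
        by (intro ereal_divide_right_mono) auto
      with mean' have "ereal (W c) \<le> ereal ((p - q) / (2 * pi))" by (metis ereal_minus(1) ereal_divide order_trans pi_neq_zero mult_eq_0_iff zero_neq_numeral)
      then show ?thesis by (simp add: field_simps)
    qed
    also have "p - q = (LINT t:{0..2*pi}|lborel. W (h t))"
      unfolding p_def q_def set_lebesgue_integral_def f_def[symmetric]
      by (rule real_lebesgue_integral_def[OF intf, symmetric])
    finally show ?thesis .
  qed
  then show "2 * pi * ?W c \<le> (LINT t:{0..2*pi}|lborel. ?W (c + of_real r * cis t))"
    by (simp add: W_def h_def)
qed

lemma psh_line_subharmonic:
  assumes "plurisubharmonic u" "b \<noteq> 0"
  shows "subharmonic (\<lambda>\<zeta>. u (a + \<zeta> *s b))"
  using assms by (simp add: plurisubharmonic_def)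

lemma psh_bounded_above_imp_constant:
  fixes u :: "complex ^ 'n \<Rightarrow> ereal"
  assumes psh: "plurisubharmonic u" and le: "\<And>z. u z \<le> ereal C"
  shows "u constant_on UNIV"
proof -
  have "u x = u y" for x y
  proof (cases "x = y")
    case False
    define v where "v \<zeta> = u (x + \<zeta> *s (y - x))" for \<zeta>
    have sh: "subharmonic v"
      unfolding v_def using psh_line_subharmonic[OF psh, of "y - x"] False by simp
    have trunc: "max (v 0) (ereal a) = max (v 1) (ereal a)" for a
    proof -
      let ?W = "\<lambda>z. real_of_ereal (max (v z) (ereal a))"
      have fin: "v z < \<infinity>" for z using sh by (simp add: subharmonic_def)
      have W: "ereal (?W z) = max (v z) (ereal a)" for z
        using fin[of z] by (cases "v z") (auto simp: max_def)
      have "?W constant_on UNIV"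
      proof (rule circle_submean_Liouville)
        show "open {z. ?W z < b}" for b
          using sh by (intro truncation_usc) (auto simp: subharmonic_def)
        show "circle_submean ?W" by (rule subharmonic_truncation_circle_submean[OF sh])
        have "ereal a \<le> ereal (?W z)" "ereal (?W z) \<le> ereal (max C a)" for z
          unfolding W using le[of "x + z *s (y - x)"] by (auto simp: v_def elim!: order_trans)
        then show "a \<le> ?W z" "?W z \<le> max C a" for z unfolding ereal_less_eq(3) by blast+
      qed
      then have "?W 0 = ?W 1" unfolding constant_on_def by auto
      then show ?thesis using W by metis
    qed
    have "v 0 = v 1"
    proof (rule ccontr)
      have less: False if "s < t" "\<And>a. max s (ereal a) = max t (ereal a)" for s t :: ereal
      proof -
        obtain a where "s < ereal a" "ereal a < t" using ereal_dense2[OF \<open>s < t\<close>] by blast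
        with that(2)[of a] show False by (simp add: max_def split: if_splits)
      qed
      assume "v 0 \<noteq> v 1"
      then show False using less[of "v 0" "v 1"] less[of "v 1" "v 0"] trunc by (metis neqE)
    qed
    then show ?thesis by (simp add: v_def)
  qed simp
  then show ?thesis by (auto simp: constant_on_def)
qed

lemma circle_submean_minus_const_nn:
  fixes W :: "complex \<Rightarrow> real"
  assumes sm: "circle_submean W" and usc: "\<And>a. open {z. W z < a}" and ge: "\<And>z. A \<le> W z"
  shows "ennreal (2 * pi * (W 0 - A)) \<le> (\<integral>\<^sup>+t\<in>{0..2*pi}. ennreal (W (cis t) - A) \<partial>lborel)"
proof -
  have contc: "continuous_on S cis" for S using continuous_on_circle[of S 0 1] by simp
  have "compact (cis ` {0..2*pi})" by (intro compact_continuous_image contc) simp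
  then obtain B where "\<And>z. z \<in> cis ` {0..2*pi} \<Longrightarrow> W z \<le> B"
    using usc_bounded_above_on_compact[OF usc] by metis
  then have int: "set_integrable lborel {0..2*pi} (\<lambda>t. W (cis t))"
    by (intro usc_compose_set_integrable[OF usc contc ge, where B = B]) auto
  have intA: "set_integrable lborel {0..2*pi} (\<lambda>_. A)"
    by (rule bounded_borel_set_integrable) auto
  have "2 * pi * W 0 \<le> (LINT t:{0..2*pi}|lborel. W (cis t))"
    using sm unfolding circle_submean_def by (drule_tac spec[of _ 0], drule_tac spec[of _ 1]) simp
  then have "2 * pi * (W 0 - A) \<le> (LINT t:{0..2*pi}|lborel. W (cis t) - A)"
    using int intA by (simp add: set_integral_diff) (simp add: set_lebesgue_integral_def algebra_simps)
  then show ?thesis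
    using ge set_integral_diff(1)[OF int intA]
    by (subst nn_integral_eq_set_integral) (auto intro: ennreal_leI)
qed

lemma entire_line_holomorphic:
  assumes "entire f"
  shows "(\<lambda>\<zeta>. f (a + \<zeta> *s b)) holomorphic_on UNIV"
proof -
  have "(\<lambda>\<zeta>. f (a + \<zeta> *s b)) field_differentiable at z" for z
  proof -
    obtain D where D: "(f has_derivative D) (at (a + z *s b))" "\<And>c v. D (c *s v) = c * D v"
      using assms unfolding entire_def by blast
    have "bounded_linear (\<lambda>\<zeta>. \<zeta> *s b)"
      by (intro linear_conv_bounded_linear[THEN iffD1] linearI) (auto simp: vec_eq_iff algebra_simps)
    then have "((\<lambda>\<zeta>. a + \<zeta> *s b) has_derivative (\<lambda>h. h *s b)) (at z)"
      by (auto intro!: derivative_eq_intros bounded_linear_imp_has_derivative)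
    from diff_chain_at[OF this D(1)]
    have "((\<lambda>\<zeta>. f (a + \<zeta> *s b)) has_derivative (\<lambda>h. D b * h)) (at z)"
      by (simp add: o_def D(2) mult.commute)
    then show ?thesis
      unfolding field_differentiable_def has_field_derivative_def by blast
  qed
  then show ?thesis by (simp add: holomorphic_on_def)
qed

lemma entire_continuous_on: "entire f \<Longrightarrow> continuous_on S f"
  unfolding entire_def
  by (meson has_derivative_continuous continuous_at_imp_continuous_on)

lemma holomorphic_log_max_circle_submean:
  assumes "g holomorphic_on UNIV" "A > 0"
  shows "circle_submean (\<lambda>z. ln (max A (cmod (g z))))" (is "circle_submean ?W")
  unfolding circle_submean_def
proof (intro allI impI)
  fix c :: complex and r :: real assume "r > 0"
  define \<phi> where "\<phi> t = ?W (c + of_real r * cis t)" for t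
  have contg: "continuous_on S (\<lambda>t. g (c + of_real r * cis t))" for S
    using holomorphic_on_imp_continuous_on[OF assms(1)]
    by (rule continuous_on_compose2) (auto intro: continuous_intros)
  have pos: "0 < max A (cmod w)" for w using \<open>A > 0\<close> by simp
  have cont: "continuous_on S \<phi>" for S
    unfolding \<phi>_def using pos
    by (intro continuous_intros contg ballI less_imp_neq[THEN not_sym])
  have int: "integral {0..2*pi} \<phi> = (LINT t:{0..2*pi}|lborel. \<phi> t)"
    using set_borel_integral_eq_integral(2)[OF borel_integrable_atLeastAtMost'[OF cont]] by simp
  have "2 * pi * ?W c \<le> integral {0..2*pi} \<phi>"
  proof (cases "A \<le> cmod (g c)")
    case True
    show ?thesis
    proof (rule log_modulus_circle_mean[where g = g and S = UNIV and c = c and r = r])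
      show "\<phi> (t + 2 * pi) = \<phi> t" for t by (simp add: \<phi>_def cis_mult[symmetric])
      show "cmod (g (c + of_real r * cis t)) \<le> exp (\<phi> t)" for t
        unfolding \<phi>_def exp_ln[OF pos] by simp
      show "exp (?W c) \<le> cmod (g c)" using True exp_ln[OF pos, of "g c"] by simp
    qed (use assms \<open>r > 0\<close> cont in auto)
  next
    case False
    then have "2 * pi * ?W c = integral {0..2*pi} (\<lambda>_. ln A)" by (simp add: max_def)
    also have "\<dots> \<le> integral {0..2*pi} \<phi>"
      using \<open>A > 0\<close> by (intro integral_le integrable_continuous_real cont) (auto simp: \<phi>_def)
    finally show ?thesis .
  qed
  then show "2 * pi * ?W c \<le> (LINT t:{0..2*pi}|lborel. ?W (c + of_real r * cis t))"
    unfolding int unfolding \<phi>_def .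
qed

lemma bounded_above_off_zero_density_imp_bounded_above:
  fixes W :: "complex ^ 'n \<Rightarrow> real"
  assumes usc: "\<And>a. open {z. W z < a}" and ge: "\<And>z. C \<le> W z"
    and off: "\<And>z. z \<notin> E \<Longrightarrow> W z \<le> C"
    and density: "has_relative_Lebesgue_density E 0"
    and sm: "\<And>a b. b \<noteq> 0 \<Longrightarrow> circle_submean (\<lambda>\<zeta>. W (a + \<zeta> *s b))"
    and growth: "\<And>z. norm z \<ge> R0 \<Longrightarrow> W z \<le> C + norm z ^ k"
  shows "W z = C"
proof -
  have "W z - C = 0"
  proof (rule zero_density_imp_zero[OF _ _ _ density, where G = "\<lambda>z. W z - C"])
    show "open {z. W z - C < a}" for a by (rule usc_diff_continuous[OF usc]) simp
    show "W z - C = 0" if "z \<notin> E" for z using off[OF that] ge[of z] by simp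
    show "ennreal (2 * pi * (W z - C)) \<le> (\<integral>\<^sup>+t\<in>{0..2*pi}. ennreal (W (z + cis t *s w) - C) \<partial>lborel)" for z w
    proof (cases "w = 0")
      case True
      then show ?thesis
        using ge[of z] by (simp add: nn_integral_cmult_indicator flip: ennreal_mult)
    next
      case False
      have cont: "continuous_on UNIV (\<lambda>\<zeta>. z + \<zeta> *s w)" by (intro continuous_intros)
      show ?thesis
        using circle_submean_minus_const_nn[OF sm[OF False, of z], of C] ge
        by (simp add: usc_compose_continuous[OF usc cont])
    qed
  qed (use ge growth in \<open>auto simp: diff_le_eq add.commute\<close>)
  then show ?thesis by simp
qed

lemma psh_bounded_off_zero_density_imp_constant:
  fixes u :: "complex ^ 'n \<Rightarrow> ereal"
  assumes density: "has_relative_Lebesgue_density E 0" and psh: "plurisubharmonic u"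
    and order: "growth_order u < \<infinity>" and off: "\<And>z. z \<notin> E \<Longrightarrow> u z \<le> ereal C"
  shows "u constant_on UNIV"
proof -
  define C' where "C' = max C 0"
  define W where "W z = real_of_ereal (max (u z) (ereal C'))" for z
  have usc: "upper_semicontinuous u" and fin: "u z < \<infinity>" for z
    using psh by (auto simp: plurisubharmonic_def)
  have Weq: "ereal (W z) = max (u z) (ereal C')" for z
    using fin[of z] by (cases "u z") (auto simp: W_def max_def)
  obtain k :: nat and R0 where R0: "\<And>z. norm z \<ge> R0 \<Longrightarrow> u z \<le> ereal (norm z ^ k)"
    using growth_order_finiteD[OF order] by metis
  have "W z = C'" for z
  proof (rule bounded_above_off_zero_density_imp_bounded_above[OF _ _ _ density])
    show "open {z. W z < a}" for a unfolding W_def by (intro truncation_usc usc fin)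
    show "C' \<le> W z" for z unfolding ereal_less_eq(3)[symmetric] Weq by simp
    show "W z \<le> C'" if "z \<notin> E" for z
      unfolding ereal_less_eq(3)[symmetric] Weq using off[OF that]
      by (auto simp: C'_def intro: order_trans)
    show "circle_submean (\<lambda>\<zeta>. W (a + \<zeta> *s b))" if "b \<noteq> 0" for a b
      unfolding W_def by (intro subharmonic_truncation_circle_submean psh_line_subharmonic psh that)
    show "W z \<le> C' + norm z ^ k" if "norm z \<ge> R0" for z
      unfolding ereal_less_eq(3)[symmetric] Weq
      using R0[OF that] zero_le_power[OF norm_ge_zero, of z k]
      by (auto simp: C'_def max_def elim!: order_trans)
  qed
  then have "u z \<le> ereal C'" for z using Weq[of z] by (metis max.cobounded1)
  then show ?thesis by (rule psh_bounded_above_imp_constant[OF psh])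
qed

lemma entire_bounded_off_zero_density_imp_constant:
  fixes f :: "complex ^ 'n \<Rightarrow> complex"
  assumes density: "has_relative_Lebesgue_density E 0" and f: "entire f"
    and order: "entire_order f < \<infinity>" and off: "\<And>z. z \<notin> E \<Longrightarrow> cmod (f z) \<le> C"
  shows "f constant_on UNIV"
proof -
  define A where "A = max C 1"
  define W where "W z = ln (max A (cmod (f z)))" for z
  have A: "A \<ge> 1" by (simp add: A_def)
  have pos: "0 < max A (cmod w)" for w using A by simp
  obtain k :: nat and R0 where R0: "\<And>z. norm z \<ge> R0 \<Longrightarrow> eln (ereal (cmod (f z))) \<le> ereal (norm z ^ k)"
    using growth_order_finiteD order unfolding entire_order_def by metis
  have W0: "W z = ln A" for z
  proof (rule bounded_above_off_zero_density_imp_bounded_above[OF _ _ _ density])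
    have "continuous_on UNIV W"
      unfolding W_def using pos
      by (intro continuous_intros entire_continuous_on f ballI less_imp_neq[THEN not_sym])
    then show "open {z. W z < a}" for a by (intro open_Collect_less continuous_intros)
    show "ln A \<le> W z" for z using A by (simp add: W_def)
    show "W z \<le> ln A" if "z \<notin> E" for z
      using off[OF that] A by (simp add: W_def A_def)
    show "circle_submean (\<lambda>\<zeta>. W (a + \<zeta> *s b))" if "b \<noteq> 0" for a b
      unfolding W_def using A by (intro holomorphic_log_max_circle_submean entire_line_holomorphic f) auto
    show "W z \<le> ln A + norm z ^ k" if "norm z \<ge> R0" for z
    proof (cases "cmod (f z) \<le> A")
      case True
      then show ?thesis by (simp add: W_def max_def)
    next
      case False
      then have "cmod (f z) > 0" "W z = ln (cmod (f z))" using A by (auto simp: W_def max_def)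
      with R0[OF that] have "W z \<le> norm z ^ k" by (simp add: eln_def)
      with A show ?thesis by (simp add: add_increasing)
    qed
  qed
  have bound: "cmod (f z) \<le> A" for z
    using W0[of z] pos A by (simp add: W_def)
  have "f x = f 0" for x
  proof -
    define g where "g \<zeta> = f (0 + \<zeta> *s x)" for \<zeta>
    have "g 1 = (\<Sum>i\<le>0. (deriv ^^ i) g 0 / fact i * 1 ^ i)"
      by (rule Liouville_polynomial[where A = 0 and B = A])
        (use entire_line_holomorphic[OF f, of 0 x] bound in \<open>auto simp: g_def\<close>)
    then show ?thesis by (simp add: g_def)
  qed
  then show ?thesis by (auto simp: constant_on_def)
qed

theorem mainTheorem2:
  fixes E :: "(complex ^ 'n) set"
  assumes "has_relative_Lebesgue_density E 0"
  shows "(\<forall>u :: complex ^ 'n \<Rightarrow> ereal.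
            plurisubharmonic u \<and> growth_order u < \<infinity> \<and> (\<exists>C :: real. \<forall>z \<in> - E. u z \<le> ereal C)
              \<longrightarrow> u constant_on UNIV) \<and>
         (\<forall>f :: complex ^ 'n \<Rightarrow> complex.
            entire f \<and> entire_order f < \<infinity> \<and> (\<exists>C :: real. \<forall>z \<in> - E. cmod (f z) \<le> C)
              \<longrightarrow> f constant_on UNIV)"
  using psh_bounded_off_zero_density_imp_constant[OF assms]
    entire_bounded_off_zero_density_imp_constant[OF assms]
  by (metis ComplI)

end
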